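(* $K_2(\mathrm{Tribes})\le\omega(m(n))=\omega(\log n)$. That is, every function $k(n)$ with $k(n)/\log n\to\infty$ (and $k(n)\le n$) belongs to $K_2(\mathrm{Tribes})$.
   Context: $\mathcal{A}(n,k,p)$ is the set of all probability distributions $\mathbb{Q}$ of $n$ bits $(X_1,\ldots,X_n)\in\{0,1\}^n$ that are $k$-wise independent (every subset of at most $k$ of the bits is independent) and satisfy $\mathbb{Q}(X_i=1)=p$ for all $i$. For $f:\{0,1\}^n\to\{0,1\}$, $\varepsilon^f(k,p)=\max_{\mathbb{Q}\in\mathcal{A}(n,k,p)}\mathbb{Q}(f=1)-\min_{\mathbb{Q}\in\mathcal{A}(n,k,p)}\mathbb{Q}(f=1)$. For a sequence $f=(f_n)$ of monotone boolean functions with a sharp threshold at $p_c$ (under fully independent bits with marginal $p$, the probability of $f_n=1$ tends to $0$ for $p<p_c$ and to $1$ for $p>p_c$), $K_2(f)$ is the class of (integer-valued) functions $k(n)$ such that $\varepsilon^{f_n}(k(n),p_c)\to0$ as $n\to\infty$. Tribes: for an integer $m\ge1$ let $n=m2^m$, and let $m(n)$ be the inverse function (so $m(n)$ is of order $\log n$). Divide the $n$ input bits into $2^m$ disjoint sets (tribes) of size $m$ each; let $y_i$ be the AND of the bits of the $i$-th tribe; $\mathrm{Tribes}_n$ is the OR of the $y_i$'s. The sequence is indexed by $n$ of the form $m2^m$ and has sharp threshold at $p_c=1/2$. *)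

theory Defs
  imports "HOL-Probability.Probability" "HOL-Library.Landau_Symbols" "HOL-Real_Asymp.Real_Asymp"
begin

section \<open>k-wise independent bits\<close>

text \<open>A point of the cube of dimension \<open>n\<close> is a function \<open>x :: nat \<Rightarrow> bool\<close> that is \<open>False\<close>
  from index \<open>n\<close> on, and the bits are \<open>x 0, \<dots>, x (n - 1)\<close>. This is the convention of
  \<^const>\<open>Pi_pmf\<close>, so that \<open>Pi_pmf {..<n} False (\<lambda>_. bernoulli_pmf p)\<close> is the law of \<open>n\<close>
  fully independent bits.\<close>

definition cube :: "nat \<Rightarrow> (nat \<Rightarrow> bool) set" where
  "cube n = PiE_dflt {..<n} False (\<lambda>_. UNIV)"

definition kwise_indep_dists :: "nat \<Rightarrow> nat \<Rightarrow> real \<Rightarrow> (nat \<Rightarrow> bool) pmf set" where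
  "kwise_indep_dists n k p = {Q. set_pmf Q \<subseteq> cube n \<and>
     (\<forall>J \<subseteq> {..<n}. card J \<le> k \<longrightarrow>
        prob_space.indep_vars (measure_pmf Q) (\<lambda>_. count_space UNIV) (\<lambda>i x. x i) J) \<and>
     (\<forall>i<n. measure_pmf.prob Q {x. x i} = p)}"

text \<open>The supremum and the infimum are a maximum and a minimum for \<open>0 \<le> p \<le> 1\<close>; see
  \<open>kwise_gap_eq_max_minus_min\<close> below.\<close>

definition kwise_gap :: "nat \<Rightarrow> ((nat \<Rightarrow> bool) \<Rightarrow> bool) \<Rightarrow> nat \<Rightarrow> real \<Rightarrow> real" where
  "kwise_gap n f k p =
     (SUP Q \<in> kwise_indep_dists n k p. measure_pmf.prob Q {x. f x}) -
     (INF Q \<in> kwise_indep_dists n k p. measure_pmf.prob Q {x. f x})"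

text \<open>A sequence of boolean functions may be indexed by an infinite set \<open>N\<close> of dimensions only;
  its limits are then taken as \<open>n\<close> tends to infinity inside \<open>N\<close>.\<close>

definition at_top_in :: "nat set \<Rightarrow> nat filter" where
  "at_top_in N = inf at_top (principal N)"

definition sharp_threshold ::
    "nat set \<Rightarrow> (nat \<Rightarrow> (nat \<Rightarrow> bool) \<Rightarrow> bool) \<Rightarrow> real \<Rightarrow> bool" where
  "sharp_threshold N f pc \<longleftrightarrow> (\<forall>p\<in>{0..1}.
     (p < pc \<longrightarrow> ((\<lambda>n. measure_pmf.prob (Pi_pmf {..<n} False (\<lambda>_. bernoulli_pmf p)) {x. f n x})
                    \<longlongrightarrow> 0) (at_top_in N)) \<and>
     (p > pc \<longrightarrow> ((\<lambda>n. measure_pmf.prob (Pi_pmf {..<n} False (\<lambda>_. bernoulli_pmf p)) {x. f n x})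
                    \<longlongrightarrow> 1) (at_top_in N)))"

text \<open>The last parameter is the point of the sharp threshold of \<open>f\<close>.\<close>

definition K2 :: "nat set \<Rightarrow> (nat \<Rightarrow> (nat \<Rightarrow> bool) \<Rightarrow> bool) \<Rightarrow> real \<Rightarrow> (nat \<Rightarrow> nat) set" where
  "K2 N f pc = {k. ((\<lambda>n. kwise_gap n (f n) (k n) pc) \<longlongrightarrow> 0) (at_top_in N)}"

section \<open>Tribes\<close>

definition tribes_sizes :: "nat set" where
  "tribes_sizes = (\<lambda>m. m * 2 ^ m) ` {1..}"

definition tribe_width :: "nat \<Rightarrow> nat" where
  "tribe_width = inv_into {1..} (\<lambda>m. m * 2 ^ m)"

definition tribes :: "nat \<Rightarrow> (nat \<Rightarrow> bool) \<Rightarrow> bool" where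
  "tribes n x \<longleftrightarrow> (let m = tribe_width n in \<exists>i<2 ^ m. \<forall>j\<in>{i * m..<Suc i * m}. x j)"

section \<open>The extrema in the gap are attained\<close>

lemma finite_cube: "finite (cube n)"
  unfolding cube_def by (intro finite_PiE_dflt) auto

lemma Pi_pmf_in_kwise_indep_dists:
  assumes "0 \<le> p" "p \<le> 1"
  shows "Pi_pmf {..<n} False (\<lambda>_. bernoulli_pmf p) \<in> kwise_indep_dists n k p"
proof -
  let ?Q = "Pi_pmf {..<n} False (\<lambda>_. bernoulli_pmf p)"
  have 1: "set_pmf ?Q \<subseteq> cube n"
    unfolding cube_def by (subst set_Pi_pmf) (auto simp: PiE_dflt_def)
  have "prob_space.indep_vars (measure_pmf ?Q) (\<lambda>_. count_space UNIV) (\<lambda>i x. x i) {..<n}"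
    by (rule indep_vars_Pi_pmf) auto
  then have 2: "prob_space.indep_vars (measure_pmf ?Q) (\<lambda>_. count_space UNIV) (\<lambda>i x. x i) J"
    if "J \<subseteq> {..<n}" for J
    using that prob_space.indep_vars_subset[OF measure_pmf.prob_space_axioms] by blast
  have 3: "measure_pmf.prob ?Q {x. x i} = p" if "i < n" for i
  proof -
    have "measure_pmf.prob ?Q {x. x i} = measure_pmf.prob (map_pmf (\<lambda>x. x i) ?Q) {True}"
      by (simp add: vimage_def)
    also have "map_pmf (\<lambda>x. x i) ?Q = bernoulli_pmf p"
      using that by (subst Pi_pmf_component) auto
    finally show ?thesis using assms by (simp add: measure_pmf_single)
  qed
  show ?thesis unfolding kwise_indep_dists_def using 1 2 3 by auto
qed

lemma indep_bits_iff:
  fixes Q :: "(nat \<Rightarrow> bool) pmf"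
  shows "prob_space.indep_vars (measure_pmf Q) (\<lambda>_. count_space UNIV) (\<lambda>i x. x i) J \<longleftrightarrow>
    (\<forall>I. I \<subseteq> J \<longrightarrow> I \<noteq> {} \<longrightarrow> finite I \<longrightarrow> (\<forall>B. measure_pmf.prob Q (\<Inter>i\<in>I. {x. x i \<in> B i}) =
        (\<Prod>i\<in>I. measure_pmf.prob Q {x. x i \<in> B i})))"
    (is "?L \<longleftrightarrow> ?R")
proof -
  have "?L \<longleftrightarrow> (\<forall>I. I \<subseteq> J \<longrightarrow> I \<noteq> {} \<longrightarrow> finite I \<longrightarrow>
      (\<forall>A\<in>Pi I (\<lambda>i. {{x :: nat \<Rightarrow> bool. x i \<in> B} | B. True}).
      measure_pmf.prob Q (\<Inter>i\<in>I. A i) = (\<Prod>i\<in>I. measure_pmf.prob Q (A i))))"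
    unfolding prob_space.indep_vars_def2[OF measure_pmf.prob_space_axioms]
      prob_space.indep_sets_def[OF measure_pmf.prob_space_axioms]
    by (simp add: vimage_def)
  also have "\<dots> \<longleftrightarrow> ?R"
  proof (intro iffI allI impI ballI)
    fix I B
    assume *: "\<forall>I. I \<subseteq> J \<longrightarrow> I \<noteq> {} \<longrightarrow> finite I \<longrightarrow>
      (\<forall>A\<in>Pi I (\<lambda>i. {{x :: nat \<Rightarrow> bool. x i \<in> B} | B. True}).
      measure_pmf.prob Q (\<Inter>i\<in>I. A i) = (\<Prod>i\<in>I. measure_pmf.prob Q (A i)))"
      and I: "I \<subseteq> J" "I \<noteq> {}" "finite I"
    show "measure_pmf.prob Q (\<Inter>i\<in>I. {x. x i \<in> B i}) =
        (\<Prod>i\<in>I. measure_pmf.prob Q {x. x i \<in> B i})"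
      by (rule *[rule_format, OF I]) auto
  next
    fix I A
    assume *: ?R and I: "I \<subseteq> J" "I \<noteq> {}" "finite I"
      and A: "A \<in> Pi I (\<lambda>i. {{x :: nat \<Rightarrow> bool. x i \<in> B} | B. True})"
    have "\<forall>i\<in>I. \<exists>B. A i = {x. x i \<in> B}" using A by (auto simp: Pi_iff)
    then obtain B where B: "\<forall>i\<in>I. A i = {x. x i \<in> B i}" by metis
    show "measure_pmf.prob Q (\<Inter>i\<in>I. A i) = (\<Prod>i\<in>I. measure_pmf.prob Q (A i))"
      using *[rule_format, OF I, of B] B by simp
  qed
  finally show ?thesis .
qed

lemma compact_kwise_indep_dists: "compact (pmf ` kwise_indep_dists n k p)"
proof -
  define S where "S = cube n"
  have fin: "finite S" unfolding S_def by (rule finite_cube)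
  define K :: "((nat \<Rightarrow> bool) \<Rightarrow> real) set"
    where "K = PiE UNIV (\<lambda>x. if x \<in> S then {0..1} else {0})"
  have "compactin (product_topology (\<lambda>_. euclidean) UNIV) K"
    unfolding K_def by (subst compactin_PiE) auto
  then have K: "compact K" by (simp add: euclidean_product_topology)
  define P :: "((nat \<Rightarrow> bool) \<Rightarrow> real) \<Rightarrow> (nat \<Rightarrow> bool) set \<Rightarrow> real"
    where "P w E = (\<Sum>x\<in>S \<inter> E. w x)" for w E
  have cont: "continuous_on UNIV (\<lambda>w. P w E)" for E
    unfolding P_def by (intro continuous_on_sum continuous_on_product_coordinates)
  define C where "C = {w. P w UNIV = 1} \<inter> (\<Inter>i\<in>{..<n}. {w. P w {x. x i} = p}) \<inter>
     (\<Inter>I\<in>{I. I \<subseteq> {..<n} \<and> card I \<le> k \<and> I \<noteq> {}}. \<Inter>B.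
        {w. P w (\<Inter>i\<in>I. {x. x i \<in> B i}) = (\<Prod>i\<in>I. P w {x. x i \<in> B i})})"
  have C: "closed C"
    unfolding C_def
    by (intro closed_Int closed_INT ballI closed_Collect_eq continuous_on_prod cont continuous_on_const)
  have C_iff: "w \<in> C \<longleftrightarrow> P w UNIV = 1 \<and> (\<forall>i<n. P w {x. x i} = p) \<and>
     (\<forall>I. I \<subseteq> {..<n} \<longrightarrow> card I \<le> k \<longrightarrow> I \<noteq> {} \<longrightarrow>
       (\<forall>B. P w (\<Inter>i\<in>I. {x. x i \<in> B i}) = (\<Prod>i\<in>I. P w {x. x i \<in> B i})))" for w
    unfolding C_def Int_iff INT_iff mem_Collect_eq
    by (simp only: Ball_def lessThan_iff imp_conjL conj_assoc UNIV_I simp_thms mem_Collect_eq)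
  have PQ: "P (pmf Q) E = measure_pmf.prob Q E" if "set_pmf Q \<subseteq> S" for Q E
  proof -
    have "measure_pmf.prob Q E = measure_pmf.prob Q (S \<inter> E)"
      using that by (intro measure_prob_cong_0) (auto simp: set_pmf_eq)
    also have "\<dots> = P (pmf Q) E"
      unfolding P_def using fin by (intro measure_measure_pmf_finite) auto
    finally show ?thesis by simp
  qed
  have mem: "Q \<in> kwise_indep_dists n k p \<longleftrightarrow> pmf Q \<in> C" if Q: "set_pmf Q \<subseteq> S" for Q
  proof -
    have "(\<forall>J \<subseteq> {..<n}. card J \<le> k \<longrightarrow>
        prob_space.indep_vars (measure_pmf Q) (\<lambda>_. count_space UNIV) (\<lambda>i x. x i) J) \<longleftrightarrow>
       (\<forall>I. I \<subseteq> {..<n} \<longrightarrow> card I \<le> k \<longrightarrow> I \<noteq> {} \<longrightarrow>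
         (\<forall>B. measure_pmf.prob Q (\<Inter>i\<in>I. {x. x i \<in> B i}) =
        (\<Prod>i\<in>I. measure_pmf.prob Q {x. x i \<in> B i})))" (is "?A \<longleftrightarrow> ?B")
    proof
      assume ?A
      show ?B
      proof (intro allI impI)
        fix I B assume I: "I \<subseteq> {..<n}" "card I \<le> k" "I \<noteq> {}"
        then have "finite I" using finite_subset by blast
        then show "measure_pmf.prob Q (\<Inter>i\<in>I. {x. x i \<in> B i}) =
          (\<Prod>i\<in>I. measure_pmf.prob Q {x. x i \<in> B i})"
          using \<open>?A\<close> I unfolding indep_bits_iff by blast
      qed
    next
      assume B: ?B
      show ?A unfolding indep_bits_iff
      proof (intro allI impI)
        fix J I B assume J: "J \<subseteq> {..<n}" "card J \<le> k" and I: "I \<subseteq> J" "I \<noteq> {}" "finite I"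
        have "card I \<le> k" using card_mono[OF finite_subset[OF J(1)] I(1)] J by auto
        then show "measure_pmf.prob Q (\<Inter>i\<in>I. {x. x i \<in> B i}) =
          (\<Prod>i\<in>I. measure_pmf.prob Q {x. x i \<in> B i})"
          using B I J by blast
      qed
    qed
    then show ?thesis
      unfolding C_iff PQ[OF Q] kwise_indep_dists_def mem_Collect_eq S_def[symmetric]
      using Q by (simp add: conj_commute)
  qed
  have "pmf ` kwise_indep_dists n k p = K \<inter> C"
  proof (intro equalityI subsetI)
    fix w assume "w \<in> pmf ` kwise_indep_dists n k p"
    then obtain Q where Q: "Q \<in> kwise_indep_dists n k p" "w = pmf Q" by auto
    then have S: "set_pmf Q \<subseteq> S" by (auto simp: kwise_indep_dists_def S_def)
    have "pmf Q \<in> K" unfolding K_def using S by (auto simp: PiE_iff pmf_le_1 set_pmf_eq)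
    then show "w \<in> K \<inter> C" using mem[OF S] Q by auto
  next
    fix w assume w: "w \<in> K \<inter> C"
    have w0: "w x \<ge> 0" "x \<notin> S \<Longrightarrow> w x = 0" for x
      using w by (auto simp: K_def PiE_iff split: if_splits dest!: spec[of _ x])
    have w1: "(\<Sum>x\<in>S. w x) = 1" using w by (simp add: C_def P_def)
    have nn: "(\<integral>\<^sup>+x. ennreal (w x) \<partial>count_space UNIV) = 1"
    proof -
      have "(\<integral>\<^sup>+x. ennreal (w x) \<partial>count_space UNIV) = (\<Sum>x\<in>S. ennreal (w x))"
        using w0 fin by (intro nn_integral_count_space'[of S]) auto
      also have "\<dots> = 1" using w0 w1 by (simp add: sum_ennreal)
      finally show ?thesis .
    qed
    have pw: "pmf (embed_pmf w) = w" using pmf_embed_pmf[of w] w0 nn by auto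
    then have "set_pmf (embed_pmf w) \<subseteq> S" using w0 by (auto simp: set_pmf_eq)
    from mem[OF this] w pw show "w \<in> pmf ` kwise_indep_dists n k p"
      by (metis IntD2 imageI)
  qed
  then show ?thesis using compact_Int_closed[OF K C] by simp
qed

lemma kwise_gap_eq_max_minus_min:
  assumes "0 \<le> p" "p \<le> 1"
  obtains Q1 Q2 where "Q1 \<in> kwise_indep_dists n k p" "Q2 \<in> kwise_indep_dists n k p"
    "\<And>Q. Q \<in> kwise_indep_dists n k p \<Longrightarrow>
       measure_pmf.prob Q2 {x. f x} \<le> measure_pmf.prob Q {x. f x} \<and>
       measure_pmf.prob Q {x. f x} \<le> measure_pmf.prob Q1 {x. f x}"
    "kwise_gap n f k p = measure_pmf.prob Q1 {x. f x} - measure_pmf.prob Q2 {x. f x}"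
proof -
  let ?A = "kwise_indep_dists n k p"
  let ?F = "\<lambda>w. \<Sum>x\<in>cube n \<inter> {x. f x}. w x :: real"
  have F: "measure_pmf.prob Q {x. f x} = ?F (pmf Q)" if "Q \<in> ?A" for Q
  proof -
    have "measure_pmf.prob Q {x. f x} = measure_pmf.prob Q (cube n \<inter> {x. f x})"
      using that by (intro measure_prob_cong_0) (auto simp: set_pmf_eq kwise_indep_dists_def)
    also have "\<dots> = ?F (pmf Q)"
      using finite_cube by (intro measure_measure_pmf_finite) auto
    finally show ?thesis .
  qed
  have ne: "pmf ` ?A \<noteq> {}" using Pi_pmf_in_kwise_indep_dists[OF assms] by blast
  have cont: "continuous_on (pmf ` ?A) ?F"
    by (rule continuous_on_subset[OF _ subset_UNIV])
       (intro continuous_on_sum continuous_on_product_coordinates)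
  obtain Q1 where Q1: "Q1 \<in> ?A" "\<And>Q. Q \<in> ?A \<Longrightarrow> ?F (pmf Q) \<le> ?F (pmf Q1)"
    using continuous_attains_sup[OF compact_kwise_indep_dists ne cont] by auto
  obtain Q2 where Q2: "Q2 \<in> ?A" "\<And>Q. Q \<in> ?A \<Longrightarrow> ?F (pmf Q2) \<le> ?F (pmf Q)"
    using continuous_attains_inf[OF compact_kwise_indep_dists ne cont] by auto
  have "(SUP Q\<in>?A. measure_pmf.prob Q {x. f x}) = measure_pmf.prob Q1 {x. f x}"
    using Q1 by (intro cSup_eq_maximum) (auto simp: F)
  moreover have "(INF Q\<in>?A. measure_pmf.prob Q {x. f x}) = measure_pmf.prob Q2 {x. f x}"
    using Q2 by (intro cInf_eq_minimum) (auto simp: F)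
  ultimately show thesis
    using Q1 Q2 by (intro that[of Q1 Q2]) (auto simp: F kwise_gap_def)
qed

section \<open>Tribes is monotone with sharp threshold at 1/2\<close>

lemma strict_mono_tribes_size: "strict_mono (\<lambda>m::nat. m * 2 ^ m)"
  by (intro strict_monoI mult_strict_mono) auto

lemma tribe_width_eq: "m \<ge> 1 \<Longrightarrow> tribe_width (m * 2 ^ m) = m"
  unfolding tribe_width_def
  by (rule inv_into_f_f[of "\<lambda>m. m * 2 ^ m"])
     (auto intro: inj_on_subset[OF strict_mono_imp_inj_on[OF strict_mono_tribes_size]])

lemma mono_tribes: "mono (tribes n)"
  unfolding tribes_def Let_def by (intro monoI) (fastforce simp: le_fun_def)

lemma tendsto_tribes_sizes:
  assumes "(\<lambda>m. g (m * 2 ^ m)) \<longlonglongrightarrow> L"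
  shows "(g \<longlongrightarrow> L) (at_top_in tribes_sizes)"
proof -
  have "filterlim tribe_width at_top (at_top_in tribes_sizes)"
    unfolding filterlim_at_top
  proof
    fix Z
    show "eventually (\<lambda>n. Z \<le> tribe_width n) (at_top_in tribes_sizes)"
      unfolding at_top_in_def eventually_inf_principal
      using eventually_ge_at_top[of "Z * 2 ^ Z"]
    proof eventually_elim
      case (elim n)
      then show ?case
        by (auto simp: tribes_sizes_def tribe_width_eq strict_mono_less_eq[OF strict_mono_tribes_size])
    qed
  qed
  from filterlim_compose[OF assms this]
  have "((\<lambda>n. g (tribe_width n * 2 ^ tribe_width n)) \<longlongrightarrow> L) (at_top_in tribes_sizes)" .
  then show ?thesis
    by (rule Lim_transform_eventually)
       (unfold at_top_in_def eventually_inf_principal,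
        rule always_eventually, auto simp: tribes_sizes_def tribe_width_eq)
qed

lemma prob_tribes:
  assumes p: "0 \<le> p" "p \<le> 1" and m: "m \<ge> 1"
  shows "measure_pmf.prob (Pi_pmf {..<m * 2 ^ m} False (\<lambda>_. bernoulli_pmf p))
           {x. tribes (m * 2 ^ m) x} = 1 - (1 - p ^ m) ^ (2 ^ m)"
proof -
  define n where "n = m * 2 ^ m"
  let ?Q = "Pi_pmf {..<n} False (\<lambda>_. bernoulli_pmf p)"
  define T where "T i = {i * m..<Suc i * m}" for i
  have T: "T i \<subseteq> {..<n}" if "i < 2 ^ m" for i
  proof -
    have "Suc i * m \<le> 2 ^ m * m" using that by (intro mult_le_mono1) simp
    then show ?thesis by (auto simp: T_def n_def mult.commute)
  qed
  have disj: "disjoint_family_on T {..<2 ^ m}"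
  proof -
    have "T i \<inter> T j = {}" if "i < j" for i j
    proof -
      have "Suc i * m \<le> j * m" using that by (intro mult_le_mono1) simp
      then show ?thesis by (auto simp: T_def)
    qed
    then show ?thesis unfolding disjoint_family_on_def by (metis Int_commute linorder_neqE_nat)
  qed
  have "prob_space.indep_vars (measure_pmf ?Q) (\<lambda>_. count_space UNIV) (\<lambda>i x. x i) {..<n}"
    by (rule indep_vars_Pi_pmf) auto
  then have 1: "prob_space.indep_vars (measure_pmf ?Q) (\<lambda>i. PiM (T i) (\<lambda>_. count_space UNIV))
      (\<lambda>i x. restrict (\<lambda>j. x j) (T i)) {..<2 ^ m}"
    using T disj by (intro prob_space.indep_vars_restrict[OF measure_pmf.prob_space_axioms]) auto
  have "prob_space.indep_vars (measure_pmf ?Q) (\<lambda>_. count_space UNIV)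
      (\<lambda>i x. \<forall>j\<in>T i. restrict (\<lambda>j. x j) (T i) j) {..<2 ^ m}"
    by (rule prob_space.indep_vars_compose2[OF measure_pmf.prob_space_axioms 1, where Y = "\<lambda>i y. \<forall>j\<in>T i. y j"])
       (auto simp: T_def)
  then have 2: "prob_space.indep_vars (measure_pmf ?Q) (\<lambda>_. count_space UNIV)
      (\<lambda>i x. \<forall>j\<in>T i. x j) {..<2 ^ m}"
    by simp
  have 3: "measure_pmf.prob ?Q {x. \<forall>j\<in>T i. x j} = p ^ m" if "i < 2 ^ m" for i
  proof -
    have "{x. \<forall>j\<in>T i. x j} = Pi {..<n} (\<lambda>j. if j \<in> T i then {True} else UNIV)"
      using T[OF that] by (auto simp: Pi_iff split: if_splits)
    then have "measure_pmf.prob ?Q {x. \<forall>j\<in>T i. x j} =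
        (\<Prod>j<n. measure_pmf.prob (bernoulli_pmf p) (if j \<in> T i then {True} else UNIV))"
      by (simp add: measure_Pi_pmf_Pi)
    also have "\<dots> = (\<Prod>j<n. if j \<in> T i then p else 1)"
      using p by (intro prod.cong) (auto simp: measure_pmf_single)
    also have "\<dots> = (\<Prod>j\<in>T i. p)"
      using T[OF that] by (subst prod.inter_restrict[symmetric]) (auto simp: Int_absorb1)
    finally show ?thesis by (simp add: T_def)
  qed
  have 4: "measure_pmf.prob ?Q {x. \<not> (\<forall>j\<in>T i. x j)} = 1 - p ^ m" if "i < 2 ^ m" for i
  proof -
    have "{x :: nat \<Rightarrow> bool. \<not> (\<forall>j\<in>T i. x j)} = UNIV - {x. \<forall>j\<in>T i. x j}" by blast
    then show ?thesis
      using measure_pmf.prob_compl[of "{x. \<forall>j\<in>T i. x j}" ?Q] 3[OF that] by simp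
  qed
  have "measure_pmf.prob ?Q (\<Inter>i\<in>{..<2 ^ m}. (\<lambda>x. \<forall>j\<in>T i. x j) -` {False} \<inter> space (measure_pmf ?Q)) =
      (\<Prod>i\<in>{..<2 ^ m::nat}. measure_pmf.prob ?Q ((\<lambda>x. \<forall>j\<in>T i. x j) -` {False} \<inter> space (measure_pmf ?Q)))"
    by (rule prob_space.indep_varsD[OF measure_pmf.prob_space_axioms 2]) (auto simp: lessThan_empty_iff)
  also have "\<dots> = (\<Prod>i\<in>{..<2 ^ m::nat}. 1 - p ^ m)"
    using 4 by (intro prod.cong) (auto simp: vimage_def)
  finally have 5: "measure_pmf.prob ?Q {x. \<forall>i<2 ^ m. \<not> (\<forall>j\<in>T i. x j)} = (1 - p ^ m) ^ (2 ^ m)"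
    by (simp add: vimage_def Ball_def flip: Collect_ball_eq)
  have "{x. tribes n x} = UNIV - {x. \<forall>i<2 ^ m. \<not> (\<forall>j\<in>T i. x j)}"
    unfolding tribes_def n_def Let_def tribe_width_eq[OF m] T_def by auto
  then show ?thesis
    using measure_pmf.prob_compl[of "{x. \<forall>i<2 ^ m. \<not> (\<forall>j\<in>T i. x j)}" ?Q] 5
    unfolding n_def[symmetric] by simp
qed

lemma sharp_threshold_tribes: "sharp_threshold tribes_sizes tribes (1 / 2)"
proof -
  have lim: "((\<lambda>n. measure_pmf.prob (Pi_pmf {..<n} False (\<lambda>_. bernoulli_pmf p)) {x. tribes n x})
          \<longlongrightarrow> L) (at_top_in tribes_sizes)"
    if p: "p \<in> {0..1}" and L: "(\<lambda>m. 1 - (1 - p ^ m) ^ (2 ^ m)) \<longlonglongrightarrow> L" for p L :: real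
  proof (rule tendsto_tribes_sizes, rule Lim_transform_eventually[OF L])
    show "\<forall>\<^sub>F m in sequentially. 1 - (1 - p ^ m) ^ 2 ^ m =
        measure_pmf.prob (Pi_pmf {..<m * 2 ^ m} False (\<lambda>_. bernoulli_pmf p)) {x. tribes (m * 2 ^ m) x}"
      using eventually_ge_at_top[of 1] by eventually_elim (use p prob_tribes in simp)
  qed
  have low: "(\<lambda>m. 1 - (1 - p ^ m) ^ (2 ^ m)) \<longlonglongrightarrow> 0" if p: "p \<in> {0..1}" "p < 1/2" for p :: real
  proof (rule tendsto_sandwich)
    show "\<forall>\<^sub>F m in sequentially. 0 \<le> 1 - (1 - p ^ m) ^ 2 ^ m"
      using p by (auto intro!: always_eventually power_le_one)
    have "1 - (1 - p ^ m) ^ 2 ^ m \<le> (2 * p) ^ m" for m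
      using Bernoulli_inequality[of "- (p ^ m)" "2 ^ m"] p
      by (simp add: power_le_one power_mult_distrib)
    then show "\<forall>\<^sub>F m in sequentially. 1 - (1 - p ^ m) ^ 2 ^ m \<le> (2 * p) ^ m" by simp
    show "(\<lambda>m. (2 * p) ^ m) \<longlonglongrightarrow> 0" using p by (intro LIMSEQ_power_zero) auto
  qed auto
  have high: "(\<lambda>m. 1 - (1 - p ^ m) ^ (2 ^ m)) \<longlonglongrightarrow> 1" if p: "p \<in> {0..1}" "p > 1/2" for p :: real
  proof -
    have "(\<lambda>m. (1 - p ^ m) ^ (2 ^ m)) \<longlonglongrightarrow> 0"
    proof (rule tendsto_sandwich)
      show "\<forall>\<^sub>F m in sequentially. 0 \<le> (1 - p ^ m) ^ 2 ^ m"
        using p by (auto intro!: always_eventually zero_le_power simp: power_le_one)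
      have "(1 - p ^ m) ^ 2 ^ m \<le> exp (- ((2 * p) ^ m))" for m
      proof -
        have "(1 - p ^ m) ^ 2 ^ m \<le> exp (- (p ^ m)) ^ 2 ^ m"
          using p exp_ge_add_one_self[of "- (p ^ m)"] by (intro power_mono) (auto simp: power_le_one)
        also have "\<dots> = exp (- ((2 * p) ^ m))"
          by (simp add: exp_of_nat_mult[symmetric] power_mult_distrib)
        finally show ?thesis .
      qed
      then show "\<forall>\<^sub>F m in sequentially. (1 - p ^ m) ^ 2 ^ m \<le> exp (- ((2 * p) ^ m))" by simp
      have "2 * p > 1" using p by simp
      then show "(\<lambda>m. exp (- ((2 * p) ^ m))) \<longlonglongrightarrow> 0" by real_asymp
    qed auto
    from tendsto_diff[OF tendsto_const[of 1] this] show ?thesis by simp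
  qed
  show ?thesis
    unfolding sharp_threshold_def using lim low high by blast
qed

end

theory Submission
  imports Defs
begin

text \<open>Put \<open>t = k div m\<close>. Any \<open>t\<close> tribes involve at most \<open>k\<close> bits, so \<open>k\<close>-wise independence
  determines the Bonferroni sums, up to order \<open>t\<close>, of the event that no tribe is all \<open>True\<close>.
  Their error is at most the \<open>t\<close>-th term \<open>(2\<^sup>m choose t) / 2\<^bsup>mt\<^esup> \<le> 1 / t!\<close>, and \<open>t\<close> tends to
  infinity because \<open>m\<close> is of order \<open>ln n\<close>.\<close>

text \<open>For \<open>n = Suc l\<close>, Pascal's rule telescopes the truncated alternating sum to
  \<open>(-1) ^ t * (l choose t)\<close>. For \<open>n = 0\<close> only the term
  \<open>j = 0\<close> survives and the error vanishes.\<close>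

lemma binomial_alternating_sum_error:
  "\<bar>(if n = 0 then 1 else 0) - (\<Sum>j\<le>t. (-1) ^ j * real (n choose j))\<bar> \<le> real (n choose t)"
proof (cases n)
  case 0
  have "(\<Sum>j\<le>t. (-1) ^ j * real (0 choose j)) = (\<Sum>j\<in>{0}. (-1) ^ j * real (0 choose j))"
    by (intro sum.mono_neutral_right) (auto simp: binomial_eq_0)
  then show ?thesis using 0 by simp
next
  case (Suc l)
  have "(\<Sum>j\<le>t. (-1) ^ j * real (Suc l choose j)) = (-1) ^ t * real (l choose t)"
    by (induction t) (simp_all add: algebra_simps)
  moreover have "l choose t \<le> Suc l choose t"
    by (cases t) simp_all
  ultimately show ?thesis using Suc by (simp add: abs_mult power_abs)
qed

text \<open>The sets \<open>J\<close> that contribute at \<open>x\<close> are the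
  \<open>j\<close>-subsets of the set of indices whose event occurs at \<open>x\<close>.\<close>

lemma sum_indicator_subsets_eq_choose:
  assumes "finite I"
  shows "(\<Sum>J | J \<subseteq> I \<and> card J = j. indicator {x. \<forall>i\<in>J. E i x} x) =
    real (card {i\<in>I. E i x} choose j)"
proof -
  have "(\<Sum>J | J \<subseteq> I \<and> card J = j. indicator {x. \<forall>i\<in>J. E i x} x) =
      (\<Sum>J | J \<subseteq> I \<and> card J = j \<and> (\<forall>i\<in>J. E i x). 1 :: real)"
    using assms by (intro sum.mono_neutral_cong_right) (auto simp: indicator_def)
  also have "\<dots> = real (card {J. J \<subseteq> {i\<in>I. E i x} \<and> card J = j})"
    by (auto intro!: arg_cong[where f = card])
  also have "\<dots> = real (card {i\<in>I. E i x} choose j)"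
    using assms by (simp add: n_subsets)
  finally show ?thesis .
qed

text \<open>Pointwise this is the bound on truncated alternating binomial sums, applied to the
  number of events that occur at \<open>x\<close>; integration over \<open>Q\<close> gives the
  claim. The error is bounded by the last included order \<open>t\<close>, not the first omitted
  one, so that only intersections of at most \<open>t\<close> events enter.\<close>

lemma Bonferroni_inequality:
  fixes Q :: "'a pmf" and E :: "'b \<Rightarrow> 'a \<Rightarrow> bool"
  assumes "finite I"
  shows "\<bar>measure_pmf.prob Q {x. \<forall>i\<in>I. \<not> E i x} -
      (\<Sum>j\<le>t. (-1) ^ j * (\<Sum>J | J \<subseteq> I \<and> card J = j. measure_pmf.prob Q {x. \<forall>i\<in>J. E i x}))\<bar>
    \<le> (\<Sum>J | J \<subseteq> I \<and> card J = t. measure_pmf.prob Q {x. \<forall>i\<in>J. E i x})" (is "\<bar>?P - ?S\<bar> \<le> ?R")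
proof -
  define F where "F j x = (\<Sum>J | J \<subseteq> I \<and> card J = j. indicator {x. \<forall>i\<in>J. E i x} x :: real)" for j x
  define G where "G x = (\<Sum>j\<le>t. (-1) ^ j * F j x)" for x
  define N where "N = {x. \<forall>i\<in>I. \<not> E i x}"
  have ind: "integrable (measure_pmf Q) (indicator A :: 'a \<Rightarrow> real)" for A
    by (rule measure_pmf.integrable_const_bound[where B = 1]) (auto simp: indicator_def)
  have int: "integrable (measure_pmf Q) (F j)" for j
    unfolding F_def by (intro Bochner_Integration.integrable_sum ind)
  have intG: "integrable (measure_pmf Q) G"
    unfolding G_def by (intro Bochner_Integration.integrable_sum integrable_mult_right int)
  have F: "measure_pmf.expectation Q (F j) =
      (\<Sum>J | J \<subseteq> I \<and> card J = j. measure_pmf.prob Q {x. \<forall>i\<in>J. E i x})" for j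
    unfolding F_def by (subst Bochner_Integration.integral_sum) (simp_all add: ind)
  have G: "measure_pmf.expectation Q G = ?S"
    unfolding G_def
    by (subst Bochner_Integration.integral_sum) (simp_all add: F int)
  have "?P - ?S = measure_pmf.expectation Q (\<lambda>x. indicator N x - G x)"
    by (subst Bochner_Integration.integral_diff) (simp_all add: G intG ind N_def)
  also have "\<bar>\<dots>\<bar> \<le> measure_pmf.expectation Q (\<lambda>x. \<bar>indicator N x - G x\<bar>)"
    by (rule integral_abs_bound)
  also have "\<dots> \<le> measure_pmf.expectation Q (F t)"
  proof (rule integral_mono)
    show "integrable (measure_pmf Q) (\<lambda>x. \<bar>indicator N x - G x\<bar>)"
      using intG by (intro integrable_abs Bochner_Integration.integrable_diff ind)
    show "integrable (measure_pmf Q) (F t)" by (rule int)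
    fix x
    \<comment> \<open>\<open>N\<close> is the event that the number of occurring events is
      zero.\<close>
    have "indicator N x = (if card {i\<in>I. E i x} = 0 then 1 else 0 :: real)"
      using assms by (auto simp: N_def indicator_def)
    then show "\<bar>indicator N x - G x\<bar> \<le> F t x"
      using binomial_alternating_sum_error[of "card {i\<in>I. E i x}" t] assms
      by (simp add: G_def F_def sum_indicator_subsets_eq_choose)
  qed
  finally show ?thesis by (simp add: F)
qed

lemma prob_all_bits_kwise_indep:
  assumes Q: "Q \<in> kwise_indep_dists n k p" and U: "U \<subseteq> {..<n}" "card U \<le> k"
  shows "measure_pmf.prob Q {x. \<forall>i\<in>U. x i} = p ^ card U"
\<comment> \<open>\<open>indep_bits_iff\<close> speaks of nonempty index sets only; for the empty
  set both sides are 1.\<close>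
proof (cases "U = {}")
  case False
  have fin: "finite U" using U(1) finite_subset by blast
  have "measure_pmf.prob Q (\<Inter>i\<in>U. {x. x i \<in> {True}}) =
      (\<Prod>i\<in>U. measure_pmf.prob Q {x. x i \<in> {True}})"
  proof -
    have "prob_space.indep_vars (measure_pmf Q) (\<lambda>_. count_space UNIV) (\<lambda>i x. x i) U"
      using Q U by (simp add: kwise_indep_dists_def)
    from this[unfolded indep_bits_iff, rule_format, OF order_refl False fin]
    show ?thesis .
  qed
  also have "\<dots> = (\<Prod>i\<in>U. p)"
    using Q U by (intro prod.cong) (auto simp: kwise_indep_dists_def)
  also have "(\<Inter>i\<in>U. {x :: nat \<Rightarrow> bool. x i \<in> {True}}) = {x. \<forall>i\<in>U. x i}" by auto
  finally show ?thesis by simp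
qed simp

text \<open>Tribes are pairwise disjoint blocks of \<open>m\<close> bits, so those in
  \<open>J\<close> together form a set of \<open>m * card J\<close> bits, few enough for
  \<open>k\<close>-wise independence to apply to their union.\<close>

lemma prob_all_tribes_kwise_indep:
  assumes Q: "Q \<in> kwise_indep_dists (m * N) k p"
    and J: "J \<subseteq> {..<N}" "m * card J \<le> k"
  shows "measure_pmf.prob Q {x. \<forall>i\<in>J. \<forall>j\<in>{i * m..<Suc i * m}. x j} = p ^ (m * card J)"
proof -
  define T where "T i = {i * m..<Suc i * m}" for i
  have fin: "finite J" using J(1) finite_subset by blast
  have "T i \<inter> T j = {}" if "i < j" for i j
  proof -
    have "Suc i * m \<le> j * m" using that by (intro mult_le_mono1) simp
    then show ?thesis by (auto simp: T_def)
  qed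
  then have disj: "T i \<inter> T j = {}" if "i \<noteq> j" for i j
    using that by (metis Int_commute linorder_neqE_nat)
  have card: "card (\<Union>i\<in>J. T i) = m * card J"
    using fin disj by (subst card_UN_disjoint) (auto simp: T_def)
  have "T i \<subseteq> {..<m * N}" if "i < N" for i
  proof -
    have "Suc i * m \<le> N * m" using that by (intro mult_le_mono1) simp
    then show ?thesis by (auto simp: T_def mult.commute)
  qed
  then have "(\<Union>i\<in>J. T i) \<subseteq> {..<m * N}" using J(1) by blast
  then have "measure_pmf.prob Q {x. \<forall>j\<in>(\<Union>i\<in>J. T i). x j} = p ^ card (\<Union>i\<in>J. T i)"
    using J(2) card by (intro prob_all_bits_kwise_indep[OF Q]) simp_all
  moreover have "{x :: nat \<Rightarrow> bool. \<forall>j\<in>(\<Union>i\<in>J. T i). x j} = {x. \<forall>i\<in>J. \<forall>j\<in>T i. x j}"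
    by blast
  ultimately show ?thesis unfolding card by (simp only: T_def)
qed

text \<open>The point is that the subtracted sum does not depend on \<open>Q\<close>, so it serves
  as a common centre for all distributions in the class.\<close>

lemma prob_no_tribe_kwise_indep:
  assumes m: "m \<ge> 1" and Q: "Q \<in> kwise_indep_dists (m * 2 ^ m) k (1 / 2)" and t: "m * t \<le> k"
  shows "\<bar>measure_pmf.prob Q {x. \<not> tribes (m * 2 ^ m) x} -
      (\<Sum>j\<le>t. (-1) ^ j * (real (2 ^ m choose j) * (1 / 2) ^ (m * j)))\<bar> \<le> 1 / fact t"
proof -
  define E where "E i x \<longleftrightarrow> (\<forall>j\<in>{i * m..<Suc i * m}. x j)" for i and x :: "nat \<Rightarrow> bool"
  define I where "I = {..<2 ^ m :: nat}"
  have I_fin: "finite I" by (simp add: I_def)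
  have S: "(\<Sum>J | J \<subseteq> I \<and> card J = j. measure_pmf.prob Q {x. \<forall>i\<in>J. E i x}) =
      real (2 ^ m choose j) * (1 / 2) ^ (m * j)" if "j \<le> t" for j
  proof -
    have "m * j \<le> k" using mult_le_mono2[OF that, of m] t by linarith
    then have "(\<Sum>J | J \<subseteq> I \<and> card J = j. measure_pmf.prob Q {x. \<forall>i\<in>J. E i x}) =
        (\<Sum>J | J \<subseteq> I \<and> card J = j. (1 / 2) ^ (m * j))"
      using prob_all_tribes_kwise_indep[OF Q]
      by (intro sum.cong) (auto simp: I_def E_def)
    then show ?thesis by (simp add: n_subsets I_def)
  qed
  have "{x. \<not> tribes (m * 2 ^ m) x} = {x. \<forall>i\<in>I. \<not> E i x}"
    using m by (auto simp: tribes_def tribe_width_eq E_def I_def Let_def)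
  then have "\<bar>measure_pmf.prob Q {x. \<not> tribes (m * 2 ^ m) x} -
      (\<Sum>j\<le>t. (-1) ^ j * (real (2 ^ m choose j) * (1 / 2) ^ (m * j)))\<bar>
      \<le> real (2 ^ m choose t) * (1 / 2) ^ (m * t)"
    using Bonferroni_inequality[of I Q E t] S by (simp add: I_fin)
  \<comment> \<open>At marginal 1/2 the expected number of all-\<open>True\<close> tribes is
    \<open>2 ^ m * (1 / 2) ^ m = 1\<close>, so the powers cancel in
    \<open>(2 ^ m choose t) * fact t \<le> (2 ^ m) ^ t\<close>.\<close>
  also have "\<dots> \<le> 1 / fact t"
  proof -
    have "real ((2 ^ m choose t) * fact t) \<le> real ((2 ^ m) ^ t)"
      using binomial_fact_pow[of "2 ^ m" t] by (simp only: of_nat_le_iff)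
    then show ?thesis
      by (simp add: divide_simps power_mult mult.commute)
  qed
  finally show ?thesis .
qed

text \<open>Both extremal distributions give the complementary event a probability within
  \<open>1 / fact t\<close> of the same number.\<close>

lemma kwise_gap_tribes_bounds:
  assumes m: "m \<ge> 1" and t: "m * t \<le> k"
  shows "0 \<le> kwise_gap (m * 2 ^ m) (tribes (m * 2 ^ m)) k (1 / 2)"
    and "kwise_gap (m * 2 ^ m) (tribes (m * 2 ^ m)) k (1 / 2) \<le> 2 / fact t"
proof -
  define n where "n = m * 2 ^ m"
  obtain Q1 Q2 where Q: "Q1 \<in> kwise_indep_dists n k (1 / 2)" "Q2 \<in> kwise_indep_dists n k (1 / 2)"
    "\<And>Q. Q \<in> kwise_indep_dists n k (1 / 2) \<Longrightarrow>
       measure_pmf.prob Q2 {x. tribes n x} \<le> measure_pmf.prob Q {x. tribes n x} \<and>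
       measure_pmf.prob Q {x. tribes n x} \<le> measure_pmf.prob Q1 {x. tribes n x}"
    and gap: "kwise_gap n (tribes n) k (1 / 2) =
      measure_pmf.prob Q1 {x. tribes n x} - measure_pmf.prob Q2 {x. tribes n x}"
    by (rule kwise_gap_eq_max_minus_min[where p = "1 / 2" and n = n and k = k and f = "tribes n"])
      (simp, simp, rule that)
  show "0 \<le> kwise_gap (m * 2 ^ m) (tribes (m * 2 ^ m)) k (1 / 2)"
    using Q(3)[OF Q(1)] gap by (simp add: n_def)
  have compl: "measure_pmf.prob Q {x. \<not> tribes n x} = 1 - measure_pmf.prob Q {x. tribes n x}" for Q
    using measure_pmf.prob_compl[of "{x. tribes n x}" Q]
    by (simp add: Compl_eq_Diff_UNIV[symmetric] Collect_neg_eq)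
  show "kwise_gap (m * 2 ^ m) (tribes (m * 2 ^ m)) k (1 / 2) \<le> 2 / fact t"
    using prob_no_tribe_kwise_indep[OF m Q(1)[unfolded n_def] t]
      prob_no_tribe_kwise_indep[OF m Q(2)[unfolded n_def] t] gap
      compl[of Q1] compl[of Q2]
    unfolding n_def abs_le_iff by simp
qed

text \<open>For \<open>n = m * 2 ^ m\<close> the quotient is \<open>ln 2 + ln m / m\<close>. The
  limit is positive, which makes the two growth scales interchangeable.\<close>

lemma ln_over_tribe_width:
  "((\<lambda>n. ln (real n) / real (tribe_width n)) \<longlongrightarrow> ln 2) (at_top_in tribes_sizes)"
proof (rule tendsto_tribes_sizes)
  have "(\<lambda>m. ln (real m * 2 ^ m) / real m) \<longlonglongrightarrow> ln 2"
    by real_asymp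
  then show "(\<lambda>m. ln (real (m * 2 ^ m)) / real (tribe_width (m * 2 ^ m))) \<longlonglongrightarrow> ln 2"
    by (rule Lim_transform_eventually)
       (use eventually_ge_at_top[of 1] in eventually_elim, simp add: tribe_width_eq)
qed

lemma eventually_in_tribes_sizes: "\<forall>\<^sub>F n in at_top_in tribes_sizes. n \<in> tribes_sizes"
  by (simp add: at_top_in_def eventually_inf_principal)

theorem theorem12:
  shows "\<omega>[at_top_in tribes_sizes](\<lambda>n. real (tribe_width n)) =
           \<omega>[at_top_in tribes_sizes](\<lambda>n. ln (real n)) \<and>
         (\<forall>k :: nat \<Rightarrow> nat.
            (\<forall>n\<in>tribes_sizes. k n \<le> n) \<and>
            filterlim (\<lambda>n. real (k n) / ln (real n)) at_top (at_top_in tribes_sizes)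
            \<longrightarrow> k \<in> K2 tribes_sizes tribes (1 / 2))"
proof (intro conjI allI impI)
  have "(\<lambda>n. ln (real n)) \<in> \<Theta>[at_top_in tribes_sizes](\<lambda>n. real (tribe_width n))"
    by (rule bigthetaI_tendsto[OF _ ln_over_tribe_width]) simp
  from landau_omega.small.cong_bigtheta[OF this]
  show "\<omega>[at_top_in tribes_sizes](\<lambda>n. real (tribe_width n)) =
      \<omega>[at_top_in tribes_sizes](\<lambda>n. ln (real n))" by simp
next
  fix k :: "nat \<Rightarrow> nat"
  assume k: "(\<forall>n\<in>tribes_sizes. k n \<le> n) \<and>
    filterlim (\<lambda>n. real (k n) / ln (real n)) at_top (at_top_in tribes_sizes)"
  \<comment> \<open>The largest number of tribes whose bits number at most
    \<open>k n\<close>.\<close>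
  define t where "t n = k n div tribe_width n" for n
  have "filterlim (\<lambda>n. ln (real n) / real (tribe_width n) * (real (k n) / ln (real n)))
      at_top (at_top_in tribes_sizes)"
    using k by (intro filterlim_tendsto_pos_mult_at_top[OF ln_over_tribe_width]) auto
  then have t: "filterlim t at_top (at_top_in tribes_sizes)"
    unfolding filterlim_at_top
  proof (intro allI)
    fix Z :: nat
    assume "\<forall>Z. \<forall>\<^sub>F n in at_top_in tribes_sizes.
      Z \<le> ln (real n) / real (tribe_width n) * (real (k n) / ln (real n))"
    then have "\<forall>\<^sub>F n in at_top_in tribes_sizes.
      real (Suc Z) \<le> ln (real n) / real (tribe_width n) * (real (k n) / ln (real n))" by blast
    then show "\<forall>\<^sub>F n in at_top_in tribes_sizes. Z \<le> t n"
    proof eventually_elim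
      case (elim n)
      \<comment> \<open>With \<open>x / 0 = 0\<close>, a zero width or logarithm would make the
        product 0. The bound \<open>Suc Z\<close> instead of \<open>Z\<close> excludes this even for
        \<open>Z = 0\<close>.\<close>
      then have "ln (real n) / real (tribe_width n) * (real (k n) / ln (real n)) > 0"
        by linarith
      then have "tribe_width n > 0" "ln (real n) \<noteq> 0"
        by (cases "tribe_width n"; cases "ln (real n) = 0"; simp)+
      with elim \<open>ln (real n) \<noteq> 0\<close> have "real (Suc Z * tribe_width n) \<le> real (k n)"
        by (simp add: field_simps)
      then have "Suc Z * tribe_width n \<le> k n" by (simp only: of_nat_le_iff)
      with \<open>tribe_width n > 0\<close> show ?case
        by (simp add: t_def less_eq_div_iff_mult_less_eq)
    qed
  qed
  \<comment> \<open>The numbers \<open>1 / fact t\<close> are the terms of the convergent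
    exponential series at 1.\<close>
  have "(\<lambda>t. 2 / fact t :: real) \<longlonglongrightarrow> 0"
    using tendsto_mult_right[OF summable_LIMSEQ_zero[OF summable_exp[of "1 :: real"]], of 2]
    by (simp add: divide_inverse)
  from filterlim_compose[OF this t]
  have lim: "((\<lambda>n. 2 / fact (t n) :: real) \<longlongrightarrow> 0) (at_top_in tribes_sizes)" .
  have bounds: "0 \<le> kwise_gap n (tribes n) (k n) (1 / 2) \<and>
      kwise_gap n (tribes n) (k n) (1 / 2) \<le> 2 / fact (t n)" if n: "n \<in> tribes_sizes" for n
  proof -
    obtain m where m: "m \<ge> 1" "n = m * 2 ^ m" using n by (auto simp: tribes_sizes_def)
    have "m * t n \<le> k n" using m by (simp add: t_def tribe_width_eq)
    from kwise_gap_tribes_bounds[OF m(1) this] m(2) show ?thesis by simp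
  qed
  show "k \<in> K2 tribes_sizes tribes (1 / 2)"
    unfolding K2_def mem_Collect_eq
    by (rule tendsto_sandwich[OF _ _ tendsto_const lim];
        rule eventually_mono[OF eventually_in_tribes_sizes]) (use bounds in blast)+
qed

end
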